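(* Let $k\ge 1$ and let $p_1,\dots,p_k$ be $k$ different prime numbers. Then there exists a connected Q2R network with $2(p_1+p_2+\cdots+p_k)$ vertices having at least one limit cycle of length $p_1\cdot p_2\cdots p_k$. In particular, there exist Q2R networks which exhibit attractors of period $T\ge e^{\Omega(\sqrt{|V(G)|\log |V(G)|})}$; that is, there are a constant $c>0$ and a sequence of Q2R networks with underlying graphs $G_m$ such that $|V(G_m)|\to\infty$ as $m\to\infty$ and such that, for every $m$, the network on $G_m$ has a limit cycle of length at least $e^{c\sqrt{|V(G_m)|\log|V(G_m)|}}$.
   Context: A (generalized) Q2R network is given by a finite simple undirected bipartite graph $G=(V,E)$ in which every vertex has even degree, together with a bipartition $V=A\sqcup B$ (every edge joins a vertex of $A$ to a vertex of $B$). It is connected if $G$ is connected. Configurations are maps $x\in\{-1,1\}^V$. The local rule at a vertex $i$ is $$f_i(x)=\begin{cases}-x_i & \text{if } \sum_{j\in N(i)}x_j=0,\\ x_i & \text{otherwise,}\end{cases}$$ where $N(i)$ is the set of neighbors of $i$. One time step of the network is the map $F:\{-1,1\}^V\to\{-1,1\}^V$ that first replaces simultaneously the states of all vertices $i\in A$ by $f_i$ evaluated on the current configuration, and then replaces simultaneously the states of all vertices $i\in B$ by $f_i$ evaluated on the resulting configuration. The network has a limit cycle (attractor) of length (period) $T$ if there is a configuration $x$ with $F^T(x)=x$ and $F^s(x)\neq x$ for all $1\le s<T$. *)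

theory Defs
  imports
    Complex_Main
    "HOL-Library.FuncSet"
    "HOL-Computational_Algebra.Primes"
    "Graph_Theory.Graph_Theory"
begin

text \<open>
  Finite simple undirected graphs are the symmetric loop-free digraphs of \<^locale>\<open>pair_graph\<close>:
  an undirected edge is a pair of opposite arcs.
\<close>

definition neighbors :: "'a pair_pre_digraph \<Rightarrow> 'a \<Rightarrow> 'a set" where
  "neighbors G i = {j. (i, j) \<in> parcs G}"

locale q2r_network = pair_graph G
  for G :: "'a pair_pre_digraph" +
  fixes A B :: "'a set"
  assumes parts_cover: "A \<union> B = pverts G"
    and parts_disjoint: "A \<inter> B = {}"
    and bipartite: "\<And>u v. (u, v) \<in> parcs G \<Longrightarrow> (u \<in> A \<and> v \<in> B) \<or> (u \<in> B \<and> v \<in> A)"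
    and even_degree: "\<And>i. i \<in> pverts G \<Longrightarrow> even (card (neighbors G i))"

text \<open>
  The name \<open>connected\<close> alone could also denote topological connectedness, hence the qualified name.
\<close>

definition connected_q2r_network :: "'a pair_pre_digraph \<Rightarrow> 'a set \<Rightarrow> 'a set \<Rightarrow> bool" where
  "connected_q2r_network G A B \<longleftrightarrow>
     q2r_network G A B \<and> Digraph_Component.connected (with_proj G)"

text \<open>
  Configurations are extensional functions (\<open>undefined\<close> outside the vertex set), so that equality
  of configurations is equality on the vertices. The maps below leave the values outside
  the vertex set untouched.
\<close>

definition configurations :: "'a pair_pre_digraph \<Rightarrow> ('a \<Rightarrow> int) set" where
  "configurations G = pverts G \<rightarrow>\<^sub>E {-1, 1}"

definition local_rule :: "'a pair_pre_digraph \<Rightarrow> 'a \<Rightarrow> ('a \<Rightarrow> int) \<Rightarrow> int" where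
  "local_rule G i x = (if (\<Sum>j\<in>neighbors G i. x j) = 0 then - x i else x i)"

definition update_part :: "'a pair_pre_digraph \<Rightarrow> 'a set \<Rightarrow> ('a \<Rightarrow> int) \<Rightarrow> ('a \<Rightarrow> int)" where
  "update_part G S x = (\<lambda>i. if i \<in> S then local_rule G i x else x i)"

definition q2r_map :: "'a pair_pre_digraph \<Rightarrow> 'a set \<Rightarrow> 'a set \<Rightarrow> ('a \<Rightarrow> int) \<Rightarrow> ('a \<Rightarrow> int)" where
  "q2r_map G A B x = update_part G B (update_part G A x)"

definition has_limit_cycle :: "'a pair_pre_digraph \<Rightarrow> 'a set \<Rightarrow> 'a set \<Rightarrow> nat \<Rightarrow> bool" where
  "has_limit_cycle G A B T \<longleftrightarrow>
     T \<ge> 1 \<and>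
     (\<exists>x \<in> configurations G.
        (q2r_map G A B ^^ T) x = x \<and>
        (\<forall>s. 1 \<le> s \<and> s < T \<longrightarrow> (q2r_map G A B ^^ s) x \<noteq> x))"

end

theory Submission
  imports Defs "HOL-Real_Asymp.Real_Asymp"
begin

text \<open>
  On a cycle of length \<open>2p\<close> the domain walls of a configuration move ballistically, and a pair of
  walls placed symmetrically about a vertex has period \<open>p\<close> while that vertex and its antipode never
  change. These frozen vertices serve as docking points: extra edges between cycles are arranged in such a
  way that at every vertex their contributions cancel (or, at frozen vertices, do not
  matter), so the linked cycles evolve independently and the period is the least common
  multiple of the \<open>p\<^sub>i\<close>.

  For the growth rate take all primes up to \<open>x\<close>. With \<open>\<theta>\<close> the logarithm of their product, \<open>\<pi>\<close> their
  number and \<open>S \<le> 2 \<pi> x\<close> the number of vertices, one has \<open>\<theta> \<ge> (\<pi> ln x) / 4\<close>, and the lower Chebyshev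
  bound \<open>\<pi> ln x \<ge> x / 4\<close> turns \<open>\<theta>\<^sup>2\<close> into a multiple of \<open>S ln S\<close>.
\<close>

section \<open>A lower Chebyshev bound\<close>

text \<open>
  With \<open>a(n,k) = k * (n choose k)\<close>, the recurrence \<open>1/a(n,k+1) = 1/a(n-1,k) - 1/a(n,k)\<close> of the Leibniz
  harmonic triangle drives the induction.
\<close>

lemma mult_choose_dvd_Lcm:
  assumes "1 \<le> k" "k \<le> n"
  shows "k * (n choose k) dvd Lcm {1..n}"
  using assms
proof (induction k arbitrary: n rule: nat_induct_at_least)
  case base
  then show ?case by (auto intro!: dvd_Lcm)
next
  case (Suc k)
  define L X where "L = Lcm {1..n}" and "X = ((n - 1) choose k)"
  have n: "k < n" using Suc.prems by simp
  have "k * X dvd Lcm {1..n - 1}" unfolding X_def using Suc n by simp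
  also have "\<dots> dvd L" unfolding L_def by (rule Lcm_subset) auto
  finally obtain s where s: "L = k * X * s" by (elim dvdE)
  from Suc n obtain t where t: "L = k * (n choose k) * t"
    unfolding L_def by (meson dvdE less_imp_le)
  have X: "(n - k) * (n choose k) = n * X"
    unfolding X_def using n binomial_absorb_comp[of n k] by simp
  have c: "Suc k * (n choose Suc k) = n * X"
    unfolding X_def using n Suc_times_binomial[of k "n - 1"] by simp
  have "(n - k) * L = k * n * X * t"
    using t X by (metis mult.assoc mult.commute)
  moreover have "n * L = k * n * X * s" using s by simp
  \<comment> \<open>Here \<open>s\<close> and \<open>t\<close> are the cofactors of
    \<open>a(n-1,k)\<close> and \<open>a(n,k)\<close> in \<open>L\<close>; the recurrence makes
    \<open>s - t\<close> the cofactor of \<open>a(n,k+1) = n * X\<close>.\<close>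
  ultimately have "k * (n * X * (s - t)) = n * L - (n - k) * L"
    by (metis diff_mult_distrib2 mult.assoc)
  also have "\<dots> = k * L" using n by (simp flip: diff_mult_distrib)
  finally have "n * X * (s - t) = L" using Suc.hyps by simp
  then show ?case unfolding c L_def by (metis dvd_triv_left)
qed

lemma multiplicity_Lcm_attained:
  fixes A :: "nat set"
  assumes "finite A" "A \<noteq> {}" "0 \<notin> A" "prime p"
  shows "\<exists>m\<in>A. multiplicity p (Lcm A) = multiplicity p m"
  using assms(1-3)
proof (induction A rule: finite_ne_induct)
  case (insert a A)
  then have "Lcm A \<noteq> 0" by (simp add: Lcm_0_iff_nat)
  then have "multiplicity p (Lcm (insert a A)) = max (multiplicity p a) (multiplicity p (Lcm A))"
    using insert by (simp add: multiplicity_lcm assms(4))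
  then show ?case using insert by (auto simp: max_def)
qed simp

text \<open>The full power of a prime in the lcm already divides a single member of
  \<open>{1..n}\<close>, so it is at most \<open>n\<close>; there is one such power for each prime
  factor.\<close>

lemma Lcm_le_power_card_primes:
  fixes n :: nat
  assumes "n \<ge> 1"
  shows "Lcm {1..n} \<le> n ^ card {p. prime p \<and> p \<le> n}"
proof -
  let ?L = "Lcm {1..n}" and ?P = "{p. prime p \<and> p \<le> n}"
  have L0: "?L \<noteq> 0" by (subst Lcm_0_iff_nat) auto
  have pow: "p ^ multiplicity p ?L \<le> n" if "prime p" for p
  proof -
    have "\<exists>m\<in>{1..n}. multiplicity p ?L = multiplicity p m"
      using that assms by (intro multiplicity_Lcm_attained) auto
    then obtain m where m: "m \<in> {1..n}" "multiplicity p ?L = multiplicity p m" by blast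
    then have "p ^ multiplicity p ?L dvd m" by (simp add: multiplicity_dvd)
    then have "p ^ multiplicity p ?L \<le> m" using m by (intro dvd_imp_le) auto
    then show ?thesis using m by simp
  qed
  have sub: "prime_factors ?L \<subseteq> ?P"
  proof
    fix p assume p: "p \<in> prime_factors ?L"
    then have "multiplicity p ?L \<ge> 1" "prime p"
      using L0 by (auto simp: prime_factors_multiplicity)
    then have "p ^ 1 \<le> p ^ multiplicity p ?L"
      by (intro power_increasing) (auto simp: prime_gt_0_nat Suc_le_eq)
    with pow[OF \<open>prime p\<close>] \<open>prime p\<close> show "p \<in> ?P" by simp
  qed
  have "?L = (\<Prod>p\<in>prime_factors ?L. p ^ multiplicity p ?L)"
    using L0 by (simp add: prod_prime_factors)
  also have "\<dots> \<le> n ^ card (prime_factors ?L)"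
    using pow assms by (intro prod_le_power) auto
  also have "\<dots> \<le> n ^ card ?P"
    using sub assms by (intro power_increasing card_mono) auto
  finally show ?thesis .
qed

text \<open>The lcm of \<open>{1..2 * n}\<close> is a multiple of
  \<open>n * ((2 * n) choose n)\<close>, which is at least \<open>4 ^ n / 2\<close>, and it is at
  most \<open>2 * n\<close> raised to the number of primes. Taking logarithms and using
  \<open>ln 2 \<ge> 1 / 2\<close> gives the bound.\<close>

lemma card_primes_lower_bound:
  assumes "n \<ge> 1"
  shows "real n / 2 \<le> real (card {p. prime p \<and> p \<le> 2 * n}) * ln (real (2 * n))"
proof -
  let ?\<pi> = "card {p. prime p \<and> p \<le> 2 * n}"
  have "n * ((2 * n) choose n) dvd Lcm {1..2 * n}"
    using assms by (intro mult_choose_dvd_Lcm) auto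
  then have "n * ((2 * n) choose n) \<le> Lcm {1..2 * n}"
    by (rule dvd_imp_le) (rule Nat.gr0I, subst (asm) Lcm_0_iff_nat, auto)
  also have "\<dots> \<le> (2 * n) ^ ?\<pi>"
    using Lcm_le_power_card_primes[of "2 * n"] assms by simp
  finally have "real n * real ((2 * n) choose n) \<le> real (2 * n) ^ ?\<pi>"
    by (metis of_nat_le_iff of_nat_mult of_nat_power)
  moreover have "4 ^ n / 2 \<le> real n * real ((2 * n) choose n)"
    using central_binomial_lower_bound[of n] assms by (simp add: field_simps)
  ultimately have "4 ^ n / 2 \<le> real (2 * n) ^ ?\<pi>" by linarith
  then have "ln (4 ^ n / 2) \<le> ln (real (2 * n) ^ ?\<pi>)"
    using assms by (subst ln_le_cancel_iff) auto
  moreover have "ln (4::real) = 2 * ln 2"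
    using ln_realpow[of "2::real" 2] by simp
  moreover have "ln (4 ^ n / 2 :: real) = real n * ln 4 - ln 2"
    "ln (real (2 * n) ^ ?\<pi>) = real ?\<pi> * ln (real (2 * n))"
    using assms by (simp_all add: ln_div ln_realpow del: of_nat_mult)
  ultimately have "(2 * real n - 1) * ln 2 \<le> real ?\<pi> * ln (real (2 * n))"
    by (simp add: algebra_simps del: of_nat_mult)
  moreover have "1 / 2 \<le> ln (2::real)"
    using ln_le_minus_one[of "1 / 2::real"] by (simp add: ln_div)
  then have "(2 * real n - 1) * (1 / 2) \<le> (2 * real n - 1) * ln 2"
    using assms by (intro mult_left_mono) auto
  moreover have "real n / 2 \<le> (2 * real n - 1) * (1 / 2)" using assms by simp
  ultimately show ?thesis by linarith
qed

text \<open>\<open>S\<close> counts the vertices when each prime \<open>p\<close> in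
  \<open>P\<close> gets a cycle of length \<open>2 * p\<close>. The first claim is the growth rate;
  the second later forces the vertex counts to infinity.\<close>

lemma prime_product_ge_exp:
  fixes n :: nat
  defines "P \<equiv> {p. prime p \<and> p \<le> 2 * n}"
  defines "S \<equiv> real (2 * \<Sum>P)"
  assumes n: "n \<ge> 1" and big: "real n \<ge> 4 * sqrt (real (2 * n)) * ln (real (2 * n))"
  shows "exp (1 / 20 * sqrt (S * ln S)) \<le> real (\<Prod>P)" and "sqrt (real n) \<le> S"
proof -
  define x L c where "x = real (2 * n)" and "L = ln x" and "c = real (card P)"
  \<comment> \<open>By \<open>big\<close>, \<open>c\<close> is at least \<open>2 * sqrt x\<close>,
    so at least half of the primes lie in \<open>Q\<close>, and each of them contributes at least
    \<open>L / 2\<close> to the logarithm of the product.\<close>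
  define Q where "Q = {p\<in>P. real p > sqrt x}"
  have fin: "finite P" unfolding P_def by simp
  have x2: "x \<ge> 2" using n by (simp add: x_def)
  have L0: "L > 0" using x2 by (simp add: L_def)
  have cL: "x / 4 \<le> c * L"
    using card_primes_lower_bound[OF n] by (simp add: x_def L_def c_def P_def)
  have "2 * sqrt x * L \<le> x / 4" using big by (simp add: x_def L_def)
  with cL have "2 * sqrt x * L \<le> c * L" by linarith
  then have c2: "2 * sqrt x \<le> c" using L0 by simp
  have "card (P - Q) \<le> card {1..nat \<lfloor>sqrt x\<rfloor>}"
  proof (rule card_mono)
    show "P - Q \<subseteq> {1..nat \<lfloor>sqrt x\<rfloor>}"
    proof
      fix p assume "p \<in> P - Q"
      then have "prime p" "real p \<le> sqrt x" by (auto simp: P_def Q_def)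
      then show "p \<in> {1..nat \<lfloor>sqrt x\<rfloor>}"
        by (simp add: le_nat_floor prime_gt_0_nat Suc_le_eq)
    qed
  qed simp
  then have "real (card (P - Q)) \<le> real (nat \<lfloor>sqrt x\<rfloor>)" by simp
  also have "\<dots> \<le> sqrt x" using x2 by (intro of_nat_floor) simp
  finally have "real (card (P - Q)) \<le> sqrt x" .
  moreover have "card (P - Q) = card P - card Q" "card Q \<le> card P"
    using fin by (auto simp: Q_def intro!: card_Diff_subset card_mono)
  ultimately have "c / 2 \<le> real (card Q)" using c2 unfolding c_def by simp
  have "c * L / 4 \<le> real (card Q) * (L / 2)"
    using mult_right_mono[OF \<open>c / 2 \<le> real (card Q)\<close>, of "L / 2"] L0 by simp
  also have "\<dots> = (\<Sum>p\<in>Q. ln (sqrt x))" using x2 by (simp add: L_def ln_sqrt)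
  also have "\<dots> \<le> (\<Sum>p\<in>Q. ln (real p))"
  proof (rule sum_mono)
    fix p assume "p \<in> Q"
    then have "sqrt x \<le> real p" by (simp add: Q_def)
    then show "ln (sqrt x) \<le> ln (real p)" using x2 by (intro ln_mono) auto
  qed
  also have "\<dots> \<le> (\<Sum>p\<in>P. ln (real p))"
    using fin by (intro sum_mono2) (auto simp: Q_def P_def prime_gt_0_nat Suc_le_eq intro!: ln_ge_zero)
  also have "\<dots> = ln (real (\<Prod>P))"
    using fin by (subst ln_prod[symmetric]) (auto simp: P_def prime_gt_0_nat)
  finally have theta: "c * L / 4 \<le> ln (real (\<Prod>P))" .

  have "real (\<Sum>P) = (\<Sum>p\<in>P. real p)" by simp
  also have "\<dots> \<le> (\<Sum>p\<in>P. x)"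
    by (intro sum_mono) (auto simp: P_def x_def simp flip: of_nat_mult)
  finally have "real (\<Sum>P) \<le> (\<Sum>p\<in>P. x)" .
  then have S_le: "S \<le> 2 * c * x" by (simp add: S_def c_def)
  have "card P = (\<Sum>p\<in>P. 1)" by simp
  also have "\<dots> \<le> \<Sum>P" by (intro sum_mono) (auto simp: P_def prime_gt_0_nat Suc_le_eq)
  finally have "2 * card P \<le> 2 * \<Sum>P" by simp
  then have S_ge: "2 * c \<le> S"
    unfolding S_def c_def by (metis of_nat_le_iff of_nat_mult of_nat_numeral)
  have "sqrt (real n) \<le> sqrt x" by (simp add: x_def)
  with S_ge c2 show "sqrt (real n) \<le> S" using x2 by (smt (verit) real_sqrt_ge_zero)
  have "1 \<le> sqrt x" using x2 by simp
  then have S1: "1 \<le> S" using S_ge c2 by linarith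
  have "P \<subseteq> {1..2 * n}" by (auto simp: P_def Suc_le_eq prime_gt_0_nat)
  then have "c \<le> x" unfolding c_def x_def using card_mono[of "{1..2*n}" P] by simp
  \<comment> \<open>A crude cubic bound is enough, since it enters only through
    \<open>ln S\<close>.\<close>
  have "S \<le> 2 * x * x" using S_le \<open>c \<le> x\<close> x2 by (smt (verit) mult_right_mono)
  also have "\<dots> \<le> x ^ 3" using x2 by (simp add: power3_eq_cube mult_right_mono)
  finally have "ln S \<le> ln (x ^ 3)" using S1 x2 by (subst ln_le_cancel_iff) auto
  then have lnS: "ln S \<le> 3 * L" using x2 by (simp add: L_def ln_realpow)
  \<comment> \<open>Rounding 24 up to the square 25 bounds the root by \<open>5 * (c * L)\<close>.
    As \<open>c * L\<close> is at most 4 times the logarithm of the product, the constant becomes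
    \<open>1 / 20\<close>.\<close>
  have sq: "24 * z * z \<le> (5 * z)\<^sup>2" for z :: real by (simp add: power2_eq_square)
  have "S * ln S \<le> (2 * c * x) * (3 * L)"
    using S_le lnS S1 by (intro mult_mono) auto
  also have "\<dots> = 24 * (c * L) * (x / 4)" by simp
  also have "\<dots> \<le> 24 * (c * L) * (c * L)"
    using cL L0 by (intro mult_left_mono) (auto simp: c_def)
  also have "\<dots> \<le> (5 * (c * L))\<^sup>2" by (rule sq)
  finally have "sqrt (S * ln S) \<le> 5 * (c * L)"
    using L0 by (intro real_le_lsqrt) (auto simp: c_def)
  then have "1 / 20 * sqrt (S * ln S) \<le> ln (real (\<Prod>P))" using theta by simp
  moreover have "real (\<Prod>P) > 0" using fin by (auto simp: P_def prime_gt_0_nat intro!: prod_pos)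
  ultimately show "exp (1 / 20 * sqrt (S * ln S)) \<le> real (\<Prod>P)"
    by (metis exp_le_cancel_iff exp_ln)
qed

lemma eventually_sqrt_mult_ln_le:
  "eventually (\<lambda>n. real n \<ge> 4 * sqrt (real (2 * n)) * ln (real (2 * n))) sequentially"
  by real_asymp

section \<open>Networks from trajectories\<close>

lemma funpow_q2r_map_trajectory:
  assumes "\<And>h. even h \<Longrightarrow> update_part G A (X h) = X (Suc h)"
    and "\<And>h. odd h \<Longrightarrow> update_part G B (X h) = X (Suc h)"
  shows "(q2r_map G A B ^^ t) (X 0) = X (2 * t)"
  by (induction t) (simp_all add: q2r_map_def assms)

text \<open>\<open>X\<close> is indexed by half steps, two per application of
  \<open>q2r_map\<close>. The divisibility equivalence gives the return at \<open>T\<close> and also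
  minimality, because no \<open>s\<close> with \<open>1 \<le> s < T\<close> is a multiple of
  \<open>T\<close>.\<close>

lemma has_limit_cycle_trajectory:
  assumes "\<And>h. even h \<Longrightarrow> update_part G A (X h) = X (Suc h)"
    and "\<And>h. odd h \<Longrightarrow> update_part G B (X h) = X (Suc h)"
    and "X 0 \<in> configurations G" "T \<ge> 1"
    and "\<And>t. X (2 * t) = X 0 \<longleftrightarrow> T dvd t"
  shows "has_limit_cycle G A B T"
  unfolding has_limit_cycle_def
  using assms(3-5) nat_dvd_not_less
  by (intro conjI bexI[of _ "X 0"]) (auto simp: funpow_q2r_map_trajectory[where X = X, OF assms(1,2)])

text \<open>Symmetry turns reachability from one root into reachability between any two vertices,
  and well-formedness keeps every path inside the vertex set, as \<open>rtrancl_on\<close>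
  demands.\<close>

lemma connected_with_projI:
  assumes wf: "pair_wf_digraph G" and sym: "sym (parcs G)" and r: "r \<in> pverts G"
    and reach: "\<And>v. v \<in> pverts G \<Longrightarrow> (r, v) \<in> (parcs G)\<^sup>*"
  shows "Digraph_Component.connected (with_proj G)"
proof -
  have "(u, v) \<in> rtrancl_on (pverts G) ((parcs G)\<^sup>s)"
    if "u \<in> pverts G" "v \<in> pverts G" for u v
  proof -
    have "(u, r) \<in> (parcs G)\<^sup>*"
      using reach[OF that(1)] sym by (meson sym_rtrancl symD)
    then have "(u, v) \<in> (parcs G)\<^sup>*" using reach[OF that(2)] by simp
    then show ?thesis
    proof (induction rule: rtrancl_induct)
      case base
      then show ?case using that by simp
    next
      case (step y z)
      then have "(y, z) \<in> (parcs G)\<^sup>s" by (simp add: symcl_def)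
      moreover have "z \<in> pverts G" using wf step by (simp add: pair_wf_digraph.in_arcsD2)
      ultimately show ?case using step.IH by (auto intro: rtrancl_on_into_rtrancl_on)
    qed
  qed
  then show ?thesis using r by (auto simp: connected_conv)
qed

text \<open>Reduces the graph-theoretic claim to neighbour sets, a 2-colouring and a trajectory on a
  convenient vertex type; \<open>enc\<close> transports these to the required type. The
  \<open>red\<close> vertices become part \<open>A\<close> and are updated at even half steps, the
  others at odd ones.\<close>

lemma network_of_trajectory:
  fixes V :: "'a set" and nb :: "'a \<Rightarrow> 'a set" and red :: "'a \<Rightarrow> bool"
    and st :: "nat \<Rightarrow> 'a \<Rightarrow> int" and enc :: "'a \<Rightarrow> 'b"
  assumes inj: "inj enc" and fin: "finite V"
    and nb_sub: "\<And>v. v \<in> V \<Longrightarrow> nb v \<subseteq> V"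
    and sym: "\<And>v w. v \<in> V \<Longrightarrow> w \<in> nb v \<Longrightarrow> v \<in> nb w"
    and red: "\<And>v w. v \<in> V \<Longrightarrow> w \<in> nb v \<Longrightarrow> red w \<longleftrightarrow> \<not> red v"
    and even: "\<And>v. v \<in> V \<Longrightarrow> even (card (nb v))"
    and r: "r \<in> V" and reach: "\<And>v. v \<in> V \<Longrightarrow> (r, v) \<in> {(v, w). v \<in> V \<and> w \<in> nb v}\<^sup>*"
    and st: "\<And>v. v \<in> V \<Longrightarrow> st 0 v \<in> {-1, 1}"
    and step: "\<And>h v. v \<in> V \<Longrightarrow> st (Suc h) v =
      (if red v = even h \<and> (\<Sum>w\<in>nb v. st h w) = 0 then - st h v else st h v)"
    and T: "T \<ge> 1" and period: "\<And>t. (\<forall>v\<in>V. st (2 * t) v = st 0 v) \<longleftrightarrow> T dvd t"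
  shows "\<exists>G A B. connected_q2r_network G A B \<and> card (pverts (G :: 'b pair_pre_digraph)) = card V
    \<and> has_limit_cycle G A B T"
proof -
  define E where "E = {(v, w). v \<in> V \<and> w \<in> nb v}"
  define G where "G = \<lparr>pverts = enc ` V, parcs = (\<lambda>(v, w). (enc v, enc w)) ` E\<rparr>"
  define A B where "A = enc ` {v\<in>V. red v}" and "B = enc ` {v\<in>V. \<not> red v}"
  \<comment> \<open>The value \<open>undefined\<close> off the image makes each \<open>X h\<close>
    extensional; updates never touch it because \<open>A\<close> and \<open>B\<close> lie in the
    image.\<close>
  define X where "X h u = (if u \<in> enc ` V then st h (inv enc u) else undefined)" for h u
  have enc [simp]: "enc x = enc y \<longleftrightarrow> x = y" "inv enc (enc x) = x" for x y
    using inj by (auto simp: inj_eq)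
  have X_enc: "v \<in> V \<Longrightarrow> X h (enc v) = st h v" for h v
    by (simp add: X_def)
  have nbG: "neighbors G (enc v) = enc ` nb v" if "v \<in> V" for v
    using that by (auto simp: neighbors_def G_def E_def)
  have "pair_graph G"
  proof
    have "E \<subseteq> V \<times> V" using nb_sub by (auto simp: E_def)
    then have "finite E" using fin finite_subset by blast
    then show "finite (parcs G)" "finite (pverts G)" using fin by (auto simp: G_def)
    show "symmetric (with_proj G)"
      using sym nb_sub by (fastforce simp: symmetric_def G_def E_def intro!: symI)
    fix e assume "e \<in> parcs G"
    then obtain v w where e: "e = (enc v, enc w)" "v \<in> V" "w \<in> nb v"
      by (auto simp: G_def E_def)
    then show "fst e \<in> pverts G" "snd e \<in> pverts G" "fst e \<noteq> snd e"
      using nb_sub red by (auto simp: G_def)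
  qed
  then interpret pair_graph G .
  have net: "q2r_network G A B"
  proof
    show "A \<union> B = pverts G" "A \<inter> B = {}" by (auto simp: A_def B_def G_def)
    show "(u \<in> A \<and> v \<in> B) \<or> (u \<in> B \<and> v \<in> A)" if "(u, v) \<in> parcs G" for u v
      using that nb_sub red by (fastforce simp: A_def B_def G_def E_def)
    show "even (card (neighbors G i))" if "i \<in> pverts G" for i
      using that even inj by (auto simp: G_def nbG[unfolded G_def] card_image inj_on_subset)
  qed
  have "Digraph_Component.connected (with_proj G)"
  proof (rule connected_with_projI)
    show "pair_wf_digraph G" ..
    show "sym (parcs G)" using pair_sym_arcs by (simp add: symmetric_def)
    show "enc r \<in> pverts G" using r by (simp add: G_def)
    fix u assume "u \<in> pverts G"
    then obtain v where v: "v \<in> V" "u = enc v" by (auto simp: G_def)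
    have "(r, v) \<in> E\<^sup>*" using reach v unfolding E_def by simp
    then have "(enc r, enc v) \<in> (parcs G)\<^sup>*"
      by (induction rule: rtrancl_induct) (auto simp: G_def intro: rtrancl_into_rtrancl)
    then show "(enc r, u) \<in> (parcs G)\<^sup>*" using v by simp
  qed
  moreover have "has_limit_cycle G A B T"
  proof (rule has_limit_cycle_trajectory[where X = X])
    have rule: "local_rule G (enc v) (X h) = (if (\<Sum>w\<in>nb v. st h w) = 0 then - st h v else st h v)"
      if "v \<in> V" for v h
    proof -
      have "(\<Sum>j\<in>neighbors G (enc v). X h j) = (\<Sum>w\<in>nb v. X h (enc w))"
        using inj that by (simp add: nbG sum.reindex inj_on_subset)
      also have "\<dots> = (\<Sum>w\<in>nb v. st h w)"
        using nb_sub that by (intro sum.cong) (auto intro: X_enc)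
      finally show ?thesis using that by (simp add: local_rule_def X_enc)
    qed
    show "update_part G A (X h) = X (Suc h)" if "even h" for h
    proof
      fix u
      show "update_part G A (X h) u = X (Suc h) u"
      proof (cases "u \<in> enc ` V")
        case True
        then show ?thesis using that
          by (auto simp: update_part_def rule A_def X_enc step)
      qed (auto simp: update_part_def A_def X_def)
    qed
    show "update_part G B (X h) = X (Suc h)" if "odd h" for h
    proof
      fix u
      show "update_part G B (X h) u = X (Suc h) u"
      proof (cases "u \<in> enc ` V")
        case True
        then show ?thesis using that
          by (auto simp: update_part_def rule B_def X_enc step)
      qed (auto simp: update_part_def B_def X_def)
    qed
    show "X 0 \<in> configurations G"
      using st by (force simp: configurations_def G_def X_def)
    fix t
    have "X (2 * t) = X 0 \<longleftrightarrow> (\<forall>v\<in>V. st (2 * t) v = st 0 v)"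
      by (auto simp: fun_eq_iff X_def)
    then show "X (2 * t) = X 0 \<longleftrightarrow> T dvd t" using period by simp
  qed (fact T)
  moreover have "card (pverts G) = card V"
    using inj by (simp add: G_def card_image inj_on_subset)
  ultimately show ?thesis using net unfolding connected_q2r_network_def by blast
qed

section \<open>Domain walls on an even cycle\<close>

definition cycle_nbrs :: "nat \<Rightarrow> nat \<Rightarrow> nat set" where
  "cycle_nbrs p j = {if Suc j = 2 * p then 0 else Suc j, if j = 0 then 2 * p - 1 else j - 1}"

text \<open>
  Index \<open>h\<close> counts half steps: even positions are updated when \<open>h\<close> is even, odd ones when it is odd.
  The two domain walls of \<open>cycle_state\<close> move symmetrically by one edge per half step between
  vertex \<open>0\<close> and its antipode \<open>p\<close>. At either end they meet and rest for one half step, so a round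
  trip takes \<open>2(p - 1) + 2 = 2p\<close> half steps.
\<close>

definition wall_radius :: "nat \<Rightarrow> nat \<Rightarrow> nat" where
  "wall_radius p h = (let r = h mod (2 * p) in if r = 0 then 0 else if r \<le> p then r - 1 else 2 * p - r)"

definition cycle_state :: "nat \<Rightarrow> nat \<Rightarrow> nat \<Rightarrow> int" where
  "cycle_state p h j = (if min j (2 * p - j) \<le> wall_radius p h then 1 else - 1)"

lemma wall_radius_less: "p \<ge> 1 \<Longrightarrow> wall_radius p h < p"
  by (auto simp: wall_radius_def Let_def)

text \<open>The radius stays between \<open>0\<close> and \<open>p - 1\<close>, so distance
  \<open>0\<close> is always inside the walls and distance \<open>p\<close> always outside. The last
  equation is the reflection symmetry about vertex \<open>0\<close>.\<close>

lemma cycle_state_0 [simp]: "cycle_state p h 0 = 1"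
  and cycle_state_antipode [simp]: "p \<ge> 1 \<Longrightarrow> cycle_state p h p = - 1"
  and cycle_state_last: "p \<ge> 1 \<Longrightarrow> cycle_state p h (2 * p - Suc 0) = cycle_state p h (Suc 0)"
  using wall_radius_less[of p h] by (auto simp: cycle_state_def min_def)

lemma cycle_state_values: "cycle_state p h j = 1 \<or> cycle_state p h j = - 1"
  by (simp add: cycle_state_def)

lemma finite_cycle_nbrs [simp]: "finite (cycle_nbrs p j)"
  by (simp add: cycle_nbrs_def)

lemma card_cycle_nbrs: "p \<ge> 2 \<Longrightarrow> j < 2 * p \<Longrightarrow> card (cycle_nbrs p j) = 2"
  by (auto simp: cycle_nbrs_def card_insert_if)

lemma cycle_nbrs_less: "k \<in> cycle_nbrs p j \<Longrightarrow> j < 2 * p \<Longrightarrow> k < 2 * p"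
  by (auto simp: cycle_nbrs_def split: if_splits)

lemma cycle_nbrs_sym: "k \<in> cycle_nbrs p j \<Longrightarrow> p \<ge> 2 \<Longrightarrow> j < 2 * p \<Longrightarrow> j \<in> cycle_nbrs p k"
  by (auto simp: cycle_nbrs_def split: if_splits)

lemma cycle_nbrs_even:
  assumes "k \<in> cycle_nbrs p j" "j < 2 * p"
  shows "even k \<longleftrightarrow> odd j"
  using assms by (auto simp: cycle_nbrs_def split: if_splits) presburger+

text \<open>\<open>d\<close> is the distance from vertex \<open>0\<close>. For
  \<open>0 < d < p\<close> the neighbours have distances \<open>d - 1\<close> and
  \<open>d + 1\<close>, and they cancel exactly when a wall separates them. At \<open>d = 0\<close>
  and \<open>d = p\<close> both neighbours have the same distance, hence equal states.\<close>

lemma sum_cycle_state_cycle_nbrs: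
  assumes "p \<ge> 2" "j < 2 * p"
  defines "d \<equiv> min j (2 * p - j)"
  shows "(\<Sum>k\<in>cycle_nbrs p j. cycle_state p h k) = 0 \<longleftrightarrow>
    0 < d \<and> d < p \<and> (d = wall_radius p h \<or> d = Suc (wall_radius p h))"
proof -
  have R: "wall_radius p h < p" using assms by (intro wall_radius_less) simp
  consider "j = 0" | "0 < j" "j < p" | "j = p" | "p < j" by linarith
  then show ?thesis
  proof cases
    case 1
    then show ?thesis using assms R
      by (simp add: cycle_nbrs_def cycle_state_def)
  next
    case 2
    then have "cycle_nbrs p j = {Suc j, j - 1}" "j - 1 \<noteq> Suc j" "d = j"
      using assms by (auto simp: cycle_nbrs_def d_def)
    moreover have "min (Suc j) (2 * p - Suc j) = Suc j" "min (j - 1) (2 * p - (j - 1)) = j - 1"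
      using 2 by auto
    ultimately show ?thesis using 2 by (auto simp: cycle_state_def)
  next
    case 3
    then have "cycle_nbrs p j = {Suc j, j - 1}" "j - 1 \<noteq> Suc j" "d = p"
      using assms by (auto simp: cycle_nbrs_def d_def)
    moreover have "min (Suc j) (2 * p - Suc j) = p - 1" "min (j - 1) (2 * p - (j - 1)) = p - 1"
      using 3 assms by auto
    ultimately show ?thesis using 3 by (auto simp: cycle_state_def)
  next
    case 4
    \<comment> \<open>Beyond the antipode the successor is the neighbour closer to vertex
      \<open>0\<close>, possibly by wrapping around to it.\<close>
    define k where "k = (if Suc j = 2 * p then 0 else Suc j)"
    have nb: "cycle_nbrs p j = {k, j - 1}" "j - 1 \<noteq> k" and d: "0 < d" "d < p"
      using assms 4 by (auto simp: cycle_nbrs_def d_def k_def)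
    have "min k (2 * p - k) = d - 1"
    proof (cases "Suc j = 2 * p")
      case True
      then have "k = 0" "d = 1" using 4 unfolding k_def d_def by (simp, linarith)
      then show ?thesis by simp
    next
      case False
      then have "k = Suc j" by (simp add: k_def)
      then show ?thesis using 4 False \<open>j < 2 * p\<close> unfolding d_def by linarith
    qed
    then have k: "cycle_state p h k = (if d - 1 \<le> wall_radius p h then 1 else - 1)"
      by (simp only: cycle_state_def)
    have "min (j - 1) (2 * p - (j - 1)) = Suc d"
      using 4 \<open>j < 2 * p\<close> unfolding d_def by linarith
    then have j: "cycle_state p h (j - 1) = (if Suc d \<le> wall_radius p h then 1 else - 1)"
      by (simp only: cycle_state_def)
    have "(\<Sum>k\<in>cycle_nbrs p j. cycle_state p h k) = cycle_state p h k + cycle_state p h (j - 1)"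
      using nb by simp
    then show ?thesis unfolding k j using d by (auto split: if_splits)
  qed
qed

text \<open>With \<open>r\<close> the half step modulo \<open>2 * p\<close>, only distances of the
  parity of \<open>r\<close> are updated. For \<open>0 < r < p\<close> the distance \<open>r\<close>
  just outside the walls qualifies and the radius grows; for \<open>r > p\<close> the distance
  \<open>2 * p - r\<close> just inside qualifies and the radius shrinks. At \<open>r = 0\<close> and
  \<open>r = p\<close> the only vertex of that parity next to a wall is frozen, hence the
  rest.\<close>

lemma cycle_state_Suc:
  assumes "p \<ge> 2" "j < 2 * p"
  shows "cycle_state p (Suc h) j = (if even j = even h \<and> (\<Sum>k\<in>cycle_nbrs p j. cycle_state p h k) = 0
    then - cycle_state p h j else cycle_state p h j)"
proof -
  define d r where "d = min j (2 * p - j)" and "r = h mod (2 * p)"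
  have r: "r < 2 * p" "Suc h mod (2 * p) = (if Suc r = 2 * p then 0 else Suc r)"
    using assms by (auto simp: r_def mod_Suc)
  have par: "even r \<longleftrightarrow> even h" "even d \<longleftrightarrow> even j"
    using assms by (auto simp: r_def d_def min_def dvd_mod_iff)
  have d: "d \<le> p" by (auto simp: d_def min_def)
  have rad: "wall_radius p h = (if r = 0 then 0 else if r \<le> p then r - 1 else 2 * p - r)"
    "wall_radius p (Suc h) = (if Suc r = 2 * p then 0 else if Suc r \<le> p then r else 2 * p - Suc r)"
    by (simp_all add: wall_radius_def r_def[symmetric] r(2))
  have "even j = even h \<longleftrightarrow> even d = even r" using par by simp
  moreover have "(if d \<le> wall_radius p (Suc h) then 1 else - 1 :: int) =
    (if even d = even r \<and> 0 < d \<and> d < p \<and> (d = wall_radius p h \<or> d = Suc (wall_radius p h))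
     then - (if d \<le> wall_radius p h then 1 else - 1) else (if d \<le> wall_radius p h then 1 else - 1))"
  proof (cases "r \<le> p")
    case True
    show ?thesis
    proof (cases "r = 0 \<or> r = p")
      case False
      then show ?thesis using True d assms(1) unfolding rad by (cases r) (auto simp: le_Suc_eq)
    next
      case True
      then show ?thesis using d assms(1) unfolding rad by auto
    qed
  next
    case False
    define e where "e = 2 * p - r"
    have e: "2 * p = r + e" "0 < e" "e < p" using r False by (auto simp: e_def)
    then have "even e \<longleftrightarrow> even r" by presburger
    with e False show ?thesis
      unfolding rad by (cases d e rule: linorder_cases) auto
  qed
  moreover have sd: "cycle_state p k j = (if d \<le> wall_radius p k then 1 else - 1)" for k
    by (simp add: cycle_state_def d_def)
  ultimately show ?thesis
    unfolding sum_cycle_state_cycle_nbrs[OF assms] sd d_def[symmetric] by simp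
qed

text \<open>Position \<open>1\<close> alone detects the period: it is \<open>-1\<close> exactly when
  the radius is \<open>0\<close>, that is at half steps congruent to \<open>0\<close> or
  \<open>1\<close> modulo \<open>2 * p\<close>, and only the former can be even.\<close>

lemma cycle_state_period:
  assumes "p \<ge> 2"
  shows "(\<forall>j<2 * p. cycle_state p (2 * t) j = cycle_state p 0 j) \<longleftrightarrow> p dvd t"
proof
  assume "p dvd t"
  then have "2 * t mod (2 * p) = 0" by simp
  then show "\<forall>j<2 * p. cycle_state p (2 * t) j = cycle_state p 0 j"
    by (simp add: cycle_state_def wall_radius_def)
next
  assume "\<forall>j<2 * p. cycle_state p (2 * t) j = cycle_state p 0 j"
  then have "cycle_state p (2 * t) 1 = cycle_state p 0 1" using assms by simp
  moreover have one: "cycle_state p h 1 = (if wall_radius p h = 0 then - 1 else 1)" for h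
  proof -
    have "min 1 (2 * p - 1) = 1" using assms by simp
    then show ?thesis unfolding cycle_state_def by simp
  qed
  moreover have "wall_radius p 0 = 0" by (simp add: wall_radius_def)
  ultimately have "wall_radius p (2 * t) = 0" by (metis one_neq_neg_one)
  moreover have "2 * t mod (2 * p) = 2 * (t mod p)" by simp
  ultimately have "2 * (t mod p) = 0 \<or> 2 * (t mod p) = 1 \<or> 2 * p \<le> 2 * (t mod p)"
    unfolding wall_radius_def Let_def by (auto split: if_splits)
  moreover have "t mod p < p" using assms by simp
  ultimately have "t mod p = 0" by linarith
  then show "p dvd t" by (simp add: dvd_eq_mod_eq_0)
qed

section \<open>Linked cycles\<close>

lemma alternating_sum: "(\<Sum>k\<in>{a..<a + 2 * m}. (- 1) ^ k) = (0::int)"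
  by (induction m) simp_all

text \<open>
  Vertex \<open>(i, j)\<close> is position \<open>j\<close> of the cycle of length \<open>2 p\<^sub>i\<close>; even positions form part \<open>A\<close>.
  Cycles \<open>i < n\<close> carry \<open>cycle_state\<close> with sign \<open>(-1)\<^sup>i\<close>, so that the vertices \<open>(i, 0)\<close> and
  \<open>(i, p\<^sub>i)\<close> are constant and alternate in sign along \<open>i\<close>. Joining an even number of consecutive vertices \<open>(i, 0)\<close>
  completely to an even number of consecutive antipodes adds \<open>0\<close> to every neighbourhood sum. The antipode lies in
  part \<open>B\<close> only when \<open>p\<^sub>i\<close> is odd; a prime \<open>2\<close> among others is therefore realised by the
  extra 4-cycle with index \<open>n\<close>, present iff \<open>N = Suc n\<close>: its constants \<open>1\<close> and \<open>-1\<close> at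
  positions \<open>0\<close> and \<open>2\<close> are both joined to the twins \<open>1\<close> and \<open>2 p\<^sub>0 - 1\<close> of cycle \<open>0\<close>. The twins
  always agree, which keeps these constants fixed, while positions \<open>1\<close> and \<open>3\<close> blink.
\<close>

locale linked_cycles =
  fixes p :: "nat \<Rightarrow> nat" and n N :: nat
  assumes n: "n \<ge> 1"
    and p_ge_2_main: "i < n \<Longrightarrow> p i \<ge> 2"
    and odd_p: "n \<ge> 2 \<Longrightarrow> i < n \<Longrightarrow> odd (p i)"
    and N: "N = n \<or> N = Suc n \<and> p n = 2"
begin

definition network_verts :: "(nat \<times> nat) set" where
  "network_verts = (SIGMA i:{..<N}. {..<2 * p i})"

text \<open>The bounds \<open>n mod 2\<close> and \<open>n - n mod 2\<close> make both ranges of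
  even length: for odd \<open>n\<close>, the last cycle offers no hub and cycle \<open>0\<close> no
  antipode. For \<open>n = 1\<close> both ranges are empty.\<close>

definition links :: "nat \<times> nat \<Rightarrow> (nat \<times> nat) set" where
  "links = (\<lambda>(i, j).
    if i < n - n mod 2 \<and> j = 0 then (\<lambda>k. (k, p k)) ` {n mod 2..<n}
    else if n mod 2 \<le> i \<and> i < n \<and> j = p i then (\<lambda>k. (k, 0)) ` {..<n - n mod 2}
    else if N = Suc n \<and> i = 0 \<and> (j = 1 \<or> j = 2 * p 0 - 1) then {(n, 0), (n, 2)}
    else if N = Suc n \<and> i = n \<and> (j = 0 \<or> j = 2) then {(0, 1), (0, 2 * p 0 - 1)}
    else {})"

definition nbrs :: "nat \<times> nat \<Rightarrow> (nat \<times> nat) set" where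
  "nbrs v = Pair (fst v) ` cycle_nbrs (p (fst v)) (snd v) \<union> links v"

text \<open>\<open>h div 2\<close> counts completed time steps. It increases exactly when
  \<open>h\<close> is odd, which is when positions \<open>1\<close> and \<open>3\<close> are
  updated.\<close>

definition blinker :: "nat \<Rightarrow> nat \<Rightarrow> int" where
  "blinker h j = (if j = 0 then 1 else if j = 2 then - 1
    else if (j = 1) = even (h div 2) then 1 else - 1)"

definition state :: "nat \<Rightarrow> nat \<times> nat \<Rightarrow> int" where
  "state h = (\<lambda>(i, j). if i < n then (- 1) ^ i * cycle_state (p i) h j else blinker h j)"

section \<open>Symmetry, bipartiteness and even degrees of the linked network\<close>

lemma mem_network_verts: "(i, j) \<in> network_verts \<longleftrightarrow> i < N \<and> j < 2 * p i"
  by (auto simp: network_verts_def)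

lemma finite_network_verts: "finite network_verts"
  by (simp add: network_verts_def)

lemma card_network_verts: "card network_verts = 2 * (\<Sum>i<N. p i)"
  by (simp add: network_verts_def sum_distrib_left)

lemma p_ge_2: "i < N \<Longrightarrow> p i \<ge> 2"
  using N p_ge_2_main by (auto simp: less_Suc_eq)

lemma p0: "p 0 \<ge> 2"
  using p_ge_2_main n by simp

lemma n_split: "n = n mod 2 + 2 * (n div 2)" "n - n mod 2 = 2 * (n div 2)"
  by presburger+

lemma links_cases [consumes 1, case_names hub antipode twin gadget none]:
  assumes "(i, j) \<in> network_verts"
  obtains
    "i < n - n mod 2" "i < n" "j = 0" "links (i, j) = (\<lambda>k. (k, p k)) ` {n mod 2..<n}"
  | "n mod 2 \<le> i" "i < n" "j = p i" "links (i, j) = (\<lambda>k. (k, 0)) ` {..<n - n mod 2}"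
  | "N = Suc n" "i = 0" "j = 1 \<or> j = 2 * p 0 - 1" "links (i, j) = {(n, 0), (n, 2)}"
  | "N = Suc n" "i = n" "j = 0 \<or> j = 2" "links (i, j) = {(0, 1), (0, 2 * p 0 - 1)}"
  | "links (i, j) = {}"
proof -
  consider (a) "i < n - n mod 2 \<and> j = 0"
    | (b) "\<not> (i < n - n mod 2 \<and> j = 0)" "n mod 2 \<le> i \<and> i < n \<and> j = p i"
    | (c) "\<not> (i < n - n mod 2 \<and> j = 0)" "\<not> (n mod 2 \<le> i \<and> i < n \<and> j = p i)"
      "N = Suc n \<and> i = 0 \<and> (j = 1 \<or> j = 2 * p 0 - 1)"
    | (d) "\<not> (i < n - n mod 2 \<and> j = 0)" "\<not> (n mod 2 \<le> i \<and> i < n \<and> j = p i)"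
      "\<not> (N = Suc n \<and> i = 0 \<and> (j = 1 \<or> j = 2 * p 0 - 1))"
      "N = Suc n \<and> i = n \<and> (j = 0 \<or> j = 2)"
    | (e) "\<not> (i < n - n mod 2 \<and> j = 0)" "\<not> (n mod 2 \<le> i \<and> i < n \<and> j = p i)"
      "\<not> (N = Suc n \<and> i = 0 \<and> (j = 1 \<or> j = 2 * p 0 - 1))"
      "\<not> (N = Suc n \<and> i = n \<and> (j = 0 \<or> j = 2))"
    by blast
  then show thesis
  proof cases
    case a
    moreover from this have "i < n" by linarith
    ultimately show thesis using that(1) by (simp add: links_def)
  next
    case b
    have "links (i, j) = (\<lambda>k. (k, 0)) ` {..<n - n mod 2}"
      unfolding links_def split_conv by (subst if_not_P[OF b(1)], subst if_P[OF b(2)]) (rule refl)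
    with b show thesis using that(2) by simp
  next
    case c
    have "links (i, j) = {(n, 0), (n, 2)}"
      unfolding links_def split_conv
      by (subst if_not_P[OF c(1)], subst if_not_P[OF c(2)], subst if_P[OF c(3)]) (rule refl)
    with c show thesis using that(3) by simp
  next
    case d
    have "links (i, j) = {(0, 1), (0, 2 * p 0 - 1)}"
      unfolding links_def split_conv
      by (subst if_not_P[OF d(1)], subst if_not_P[OF d(2)], subst if_not_P[OF d(3)],
          subst if_P[OF d(4)]) (rule refl)
    with d show thesis using that(4) by simp
  next
    case e
    have "links (i, j) = {}"
      unfolding links_def split_conv
      by (subst if_not_P[OF e(1)], subst if_not_P[OF e(2)], subst if_not_P[OF e(3)],
          subst if_not_P[OF e(4)]) (rule refl)
    then show thesis by (rule that(5))
  qed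
qed

lemma links_hub: "i < n - n mod 2 \<Longrightarrow> links (i, 0) = (\<lambda>k. (k, p k)) ` {n mod 2..<n}"
  by (simp add: links_def)

lemma links_antipode:
  "n mod 2 \<le> i \<Longrightarrow> i < n \<Longrightarrow> links (i, p i) = (\<lambda>k. (k, 0)) ` {..<n - n mod 2}"
  using p_ge_2_main[of i] by (simp add: links_def)

lemma links_twin:
  assumes "N = Suc n" "j = 1 \<or> j = 2 * p 0 - 1"
  shows "links (0, j) = {(n, 0), (n, 2)}"
proof -
  have "j \<noteq> 0" "j \<noteq> p 0" using assms p0 by auto
  then show ?thesis unfolding links_def split_conv using assms by simp
qed

lemma links_gadget:
  assumes "N = Suc n" "j = 0 \<or> j = 2"
  shows "links (n, j) = {(0, 1), (0, 2 * p 0 - 1)}"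
proof -
  have "\<not> n < n - n mod 2" by simp
  then show ?thesis unfolding links_def split_conv using assms n by simp
qed

lemma links_sym:
  assumes "v \<in> network_verts" "w \<in> links v"
  shows "v \<in> links w"
proof -
  obtain i j where v: "v = (i, j)" by (cases v)
  from assms(1)[unfolded v] show ?thesis
  proof (cases rule: links_cases)
    case hub
    with assms v obtain k where "w = (k, p k)" "n mod 2 \<le> k" "k < n" by auto
    with hub v show ?thesis by (simp add: links_antipode)
  next
    case antipode
    with assms v obtain k where "w = (k, 0)" "k < n - n mod 2" by auto
    with antipode v show ?thesis by (simp add: links_hub)
  next
    case twin
    then obtain k where "w = (n, k)" "k = 0 \<or> k = 2" using assms(2) v by blast
    then have "links w = {(0, 1), (0, 2 * p 0 - 1)}" using links_gadget[OF twin(1)] by simp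
    then show ?thesis using twin(2,3) v by blast
  next
    case gadget
    then obtain k where "w = (0, k)" "k = 1 \<or> k = 2 * p 0 - 1" using assms(2) v by blast
    then have "links w = {(n, 0), (n, 2)}" using links_twin[OF gadget(1)] by simp
    then show ?thesis using gadget(2,3) v by blast
  qed (use assms v in simp)
qed

lemma links_subset:
  assumes "v \<in> network_verts"
  shows "links v \<subseteq> network_verts"
proof -
  obtain i j where v: "v = (i, j)" by (cases v)
  have pos: "(k, p k) \<in> network_verts" "(k, 0) \<in> network_verts" if "k < n" for k
    using p_ge_2_main[OF that] that N by (auto simp: mem_network_verts)
  have "(0, 1) \<in> network_verts" "(0, 2 * p 0 - 1) \<in> network_verts"
    using p0 n N by (auto simp: mem_network_verts)
  moreover have "(n, 0) \<in> network_verts" "(n, 2) \<in> network_verts" if "N = Suc n"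
    unfolding mem_network_verts using that N by auto
  moreover have "k < n" if "k < n - n mod 2" for k using that by linarith
  ultimately have *: "{(0, 1), (0, 2 * p 0 - 1)} \<subseteq> network_verts"
    "N = Suc n \<Longrightarrow> {(n, 0), (n, 2)} \<subseteq> network_verts"
    "(\<lambda>k. (k, p k)) ` {n mod 2..<n} \<subseteq> network_verts"
    "(\<lambda>k. (k, 0)) ` {..<n - n mod 2} \<subseteq> network_verts"
    using pos by (blast, blast, fastforce, fastforce)
  from assms[unfolded v] show ?thesis
  proof (cases rule: links_cases)
    case hub
    show ?thesis unfolding v hub(4) by (rule *)
  next
    case antipode
    show ?thesis unfolding v antipode(4) by (rule *)
  next
    case twin
    show ?thesis unfolding v twin(4) by (rule *, rule twin)
  next
    case gadget
    show ?thesis unfolding v gadget(4) by (rule *)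
  qed (simp add: v)
qed

lemma card_links:
  assumes "v \<in> network_verts"
  shows "finite (links v)" "even (card (links v))"
proof -
  obtain i j where v: "v = (i, j)" by (cases v)
  have "finite (links v) \<and> even (card (links v))"
    using assms[unfolded v]
  proof (cases rule: links_cases)
    case hub
    then show ?thesis using v n_split by (simp add: card_image inj_on_def)
  next
    case antipode
    then show ?thesis using v n_split by (simp add: card_image inj_on_def)
  next
    case twin
    then show ?thesis using v by simp
  next
    case gadget
    have "1 \<noteq> 2 * p 0 - 1" using p0 by linarith
    then show ?thesis using v gadget by simp
  qed (use v in simp)
  then show "finite (links v)" "even (card (links v))" by auto
qed

text \<open>Lets degrees and neighbourhood sums split into a cycle part and a link part. A link
  within one cycle can only join \<open>0\<close> to its antipode, and these are not adjacent since
  \<open>p i \<ge> 2\<close>.\<close>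

lemma cycle_links_disjoint:
  assumes "v \<in> network_verts"
  shows "Pair (fst v) ` cycle_nbrs (p (fst v)) (snd v) \<inter> links v = {}"
proof -
  obtain i j where v: "v = (i, j)" by (cases v)
  from assms[unfolded v] show ?thesis
  proof (cases rule: links_cases)
    case hub
    then show ?thesis using v p_ge_2_main[of i] by (auto simp: cycle_nbrs_def)
  next
    case antipode
    then show ?thesis using v p_ge_2_main[of i] by (auto simp: cycle_nbrs_def split: if_splits)
  next
    case twin
    then show ?thesis using v n by auto
  next
    case gadget
    then show ?thesis using v n by auto
  qed (use v in simp)
qed

lemma nbrs_subset:
  assumes "v \<in> network_verts"
  shows "nbrs v \<subseteq> network_verts"
  using assms links_subset[OF assms] by (cases v) (auto simp: nbrs_def mem_network_verts intro: cycle_nbrs_less)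

lemma nbrs_sym:
  assumes "v \<in> network_verts" "w \<in> nbrs v"
  shows "v \<in> nbrs w"
proof (cases "w \<in> links v")
  case True
  then show ?thesis using links_sym[OF assms(1)] by (simp add: nbrs_def)
next
  case False
  then show ?thesis using assms p_ge_2
    by (cases v) (auto simp: nbrs_def mem_network_verts dest: cycle_nbrs_sym)
qed

lemma nbrs_even:
  assumes "v \<in> network_verts" "w \<in> nbrs v"
  shows "even (snd w) \<longleftrightarrow> odd (snd v)"
proof (cases "w \<in> links v")
  case False
  then show ?thesis using assms
    by (cases v) (auto simp: nbrs_def mem_network_verts dest: cycle_nbrs_even)
next
  case True
  \<comment> \<open>Hub-antipode links exist only for \<open>n \<ge> 2\<close>, and then all main
    \<open>p i\<close> are odd, so these links join opposite parities.\<close>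
  have n2: "n \<ge> 2" if "k < n - n mod 2" for k
  proof -
    have "0 < 2 * (n div 2)" using that n_split(2) by linarith
    then show ?thesis by presburger
  qed
  have odd_last: "odd (2 * p 0 - 1)" using p0 by presburger
  obtain i j where v: "v = (i, j)" by (cases v)
  from assms(1)[unfolded v] show ?thesis
  proof (cases rule: links_cases)
    case hub
    then obtain k where "w = (k, p k)" "k < n" using True v by auto
    then show ?thesis using odd_p[OF n2[OF hub(1)]] hub v by simp
  next
    case antipode
    then obtain k where "w = (k, 0)" "k < n - n mod 2" using True v by auto
    then show ?thesis using odd_p[OF n2] antipode v by simp
  next
    case twin
    then obtain k where "w = (n, k)" "k = 0 \<or> k = 2" using True v by blast
    moreover have "odd j" using twin(3) odd_last by (elim disjE) simp_all
    ultimately show ?thesis using v by auto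
  next
    case gadget
    then obtain k where "w = (0, k)" "k = 1 \<or> k = 2 * p 0 - 1" using True v by blast
    moreover from this have "odd k" using odd_last by (elim disjE) simp_all
    ultimately show ?thesis using v gadget(3) by auto
  qed (use True v in simp)
qed

lemma card_nbrs:
  assumes "v \<in> network_verts"
  shows "even (card (nbrs v))"
proof -
  have "card (nbrs v) = card (cycle_nbrs (p (fst v)) (snd v)) + card (links v)"
    unfolding nbrs_def using assms
    by (subst card_Un_disjoint) (auto simp: card_links card_image inj_on_def cycle_links_disjoint)
  also have "card (cycle_nbrs (p (fst v)) (snd v)) = 2"
    using assms p_ge_2 by (cases v) (auto simp: mem_network_verts intro: card_cycle_nbrs)
  finally show ?thesis using card_links[OF assms] by simp
qed

section \<open>Dynamics, period and connectedness of the linked network\<close>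

lemma sum_nbrs:
  assumes "(i, j) \<in> network_verts"
  shows "(\<Sum>w\<in>nbrs (i, j). f w) = (\<Sum>k\<in>cycle_nbrs (p i) j. f (i, k)) + (\<Sum>w\<in>links (i, j). f w)"
  unfolding nbrs_def using cycle_links_disjoint[OF assms] card_links[OF assms]
  by (subst sum.union_disjoint) (auto simp: sum.reindex inj_on_def)

text \<open>Hubs and antipodes have constant states alternating in \<open>k\<close>, summed over
  ranges of even length; the two gadget vertices contribute \<open>1\<close> and \<open>-1\<close>.
  On cycle \<open>n\<close> itself the twins add up instead of cancelling, hence
  \<open>i < n\<close>.\<close>

lemma sum_links:
  assumes "(i, j) \<in> network_verts" "i < n"
  shows "(\<Sum>w\<in>links (i, j). state h w) = 0"
  using assms(1)
proof (cases rule: links_cases)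
  case hub
  have "(\<Sum>w\<in>links (i, j). state h w) = (\<Sum>k\<in>{n mod 2..<n}. state h (k, p k))"
    unfolding hub(4) by (subst sum.reindex) (auto simp: inj_on_def)
  also have "\<dots> = (\<Sum>k\<in>{n mod 2..<n}. - ((- 1) ^ k))"
    using p_ge_2_main by (intro sum.cong) (fastforce simp: state_def)+
  also have "\<dots> = 0"
    using alternating_sum[of "n mod 2" "n div 2"] n_split by (simp add: sum_negf)
  finally show ?thesis .
next
  case antipode
  have "(\<Sum>w\<in>links (i, j). state h w) = (\<Sum>k\<in>{..<n - n mod 2}. state h (k, 0))"
    unfolding antipode(4) by (subst sum.reindex) (auto simp: inj_on_def)
  also have "\<dots> = (\<Sum>k\<in>{..<n - n mod 2}. (- 1) ^ k)"
    by (intro sum.cong) (auto simp: state_def)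
  also have "\<dots> = 0"
    unfolding n_split(2) using alternating_sum[of 0 "n div 2"] by (simp add: atLeast0LessThan)
  finally show ?thesis .
next
  case twin
  then show ?thesis by (simp add: state_def blinker_def)
qed (use assms in auto)

text \<open>On a main cycle the links vanish from the sum and the sign \<open>(-1) ^ i\<close>
  commutes with the rule. On the 4-cycle, positions \<open>0\<close> and \<open>2\<close> see
  cancelling blinkers plus two equal twins, so they never flip; positions \<open>1\<close> and
  \<open>3\<close> see \<open>1\<close> and \<open>-1\<close>, so they flip at every update.\<close>

lemma state_Suc:
  assumes "v \<in> network_verts"
  shows "state (Suc h) v = (if even (snd v) = even h \<and> (\<Sum>w\<in>nbrs v. state h w) = 0
    then - state h v else state h v)"
proof -
  obtain i j where v: "v = (i, j)" by (cases v)
  note V = assms[unfolded v]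
  show ?thesis
  proof (cases "i < n")
    case True
    have "(\<Sum>w\<in>nbrs v. state h w) = (- 1) ^ i * (\<Sum>k\<in>cycle_nbrs (p i) j. cycle_state (p i) h k)"
      using True unfolding v sum_nbrs[OF V] sum_links[OF V True]
      by (simp add: state_def sum_distrib_left)
    then show ?thesis
      using True V p_ge_2[of i] cycle_state_Suc[of "p i" j h] unfolding v
      by (simp add: state_def mem_network_verts)
  next
    case False
    with V N have "i = n" by (auto simp: mem_network_verts)
    with V N have i: "i = n" "N = Suc n" "p n = 2" "j < 4" by (auto simp: mem_network_verts)
    have nb: "cycle_nbrs 2 0 = {1, 3}" "cycle_nbrs 2 1 = {2, 0}"
      "cycle_nbrs 2 2 = {3, 1}" "cycle_nbrs 2 3 = {0, 2}"
      by (auto simp: cycle_nbrs_def)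
    consider "j = 0 \<or> j = 2" | "j = 1 \<or> j = 3" using i by linarith
    then show ?thesis
    proof cases
      case 1
      have "(\<Sum>k\<in>cycle_nbrs (p i) j. state h (i, k)) = 0"
        using 1 i nb by (auto simp: state_def blinker_def)
      moreover have "1 \<noteq> 2 * p 0 - 1" using p0 by linarith
      then have "(\<Sum>w\<in>links (i, j). state h w) = 2 * cycle_state (p 0) h 1"
        using links_gadget[OF i(2) 1] n p0 i
        by (simp add: state_def cycle_state_last)
      moreover have "cycle_state (p 0) h 1 \<noteq> 0" using cycle_state_values[of "p 0" h 1] by auto
      ultimately have "(\<Sum>w\<in>nbrs v. state h w) \<noteq> 0"
        unfolding v sum_nbrs[OF V] by simp
      then show ?thesis using 1 i v by (auto simp: state_def blinker_def)
    next
      case 2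
      have "(\<Sum>k\<in>cycle_nbrs (p i) j. state h (i, k)) = 0"
        using 2 i nb by (auto simp: state_def blinker_def)
      moreover have "links (i, j) = {}"
        unfolding links_def split_conv using 2 i n by auto
      ultimately have "(\<Sum>w\<in>nbrs v. state h w) = 0"
        unfolding v sum_nbrs[OF V] by simp
      moreover have "even (Suc h div 2) \<longleftrightarrow> (even h = even (h div 2))" by presburger
      ultimately show ?thesis using 2 i v by (auto simp: state_def blinker_def)
    qed
  qed
qed

lemma state_period:
  "(\<forall>v\<in>network_verts. state (2 * t) v = state 0 v) \<longleftrightarrow> (\<forall>i<N. p i dvd t)"
proof -
  have "(\<forall>j<2 * p i. state (2 * t) (i, j) = state 0 (i, j)) \<longleftrightarrow> p i dvd t" if "i < N" for i
  proof (cases "i < n")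
    case True
    then show ?thesis using cycle_state_period[of "p i" t] p_ge_2_main by (simp add: state_def)
  next
    case False
    with that N have "i = n" by auto
    with that N have i: "i = n" "p i = 2" by auto
    have "(\<forall>j<4. blinker (2 * t) j = blinker 0 j) \<longleftrightarrow> even t"
    proof
      assume "\<forall>j<4. blinker (2 * t) j = blinker 0 j"
      then have "blinker (2 * t) 1 = blinker 0 1" by simp
      then show "even t" by (simp add: blinker_def split: if_splits)
    qed (simp add: blinker_def)
    then show ?thesis using i by (simp add: state_def)
  qed
  then show ?thesis by (auto simp: network_verts_def)
qed

text \<open>A path goes from \<open>(0, 0)\<close> by a link to the antipode of cycle
  \<open>i\<close> and then along that cycle; the gadget is entered through the twin
  \<open>(0, 1)\<close>.\<close>

lemma reachable:
  assumes "v \<in> network_verts"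
  shows "((0, 0), v) \<in> {(v, w). v \<in> network_verts \<and> w \<in> nbrs v}\<^sup>*" (is "_ \<in> ?E\<^sup>*")
proof -
  have "sym ?E" by (auto intro!: symI dest: nbrs_sym subsetD[OF nbrs_subset])
  then have symE: "sym (?E\<^sup>*)" by (rule sym_rtrancl)
  have cyc: "((i, 0), (i, j)) \<in> ?E\<^sup>*" if "(i, j) \<in> network_verts" for i j
    using that
  proof (induction j)
    case (Suc j)
    then have "((i, 0), (i, j)) \<in> ?E\<^sup>*" "(i, j) \<in> network_verts" by (simp_all add: mem_network_verts)
    moreover have "(i, Suc j) \<in> nbrs (i, j)"
      using Suc.prems by (auto simp: nbrs_def cycle_nbrs_def mem_network_verts)
    ultimately show ?case by (auto intro: rtrancl_into_rtrancl)
  qed simp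
  obtain i j where v: "v = (i, j)" by (cases v)
  have i: "i < N" "0 < N" "n \<le> N" using assms v n N by (auto simp: mem_network_verts)
  have V0: "(i, 0) \<in> network_verts" "(i, p i) \<in> network_verts" "(0, 0) \<in> network_verts" "(0, 1) \<in> network_verts"
    using i p_ge_2[OF i(1)] p0 by (auto simp: mem_network_verts)
  have "((0, 0), (i, 0)) \<in> ?E\<^sup>*"
  proof (cases "i < n")
    case True
    show ?thesis
    proof (cases "i = 0")
      case False
      \<comment> \<open>The antipode range omits at most cycle \<open>0\<close>, so hub
        \<open>(0, 0)\<close> is linked to every other main cycle.\<close>
      have "0 < n - n mod 2" "n mod 2 \<le> i" using True False by presburger+
      then have "(i, p i) \<in> links (0, 0)" using True by (simp add: links_hub)
      then have "((0, 0), (i, p i)) \<in> ?E" using V0 by (simp add: nbrs_def)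
      moreover have "((i, p i), (i, 0)) \<in> ?E\<^sup>*" using cyc[OF V0(2)] symE by (simp add: symD)
      ultimately show ?thesis by (rule converse_rtrancl_into_rtrancl)
    qed simp
  next
    case False
    then have "i = n" "N = Suc n" using i N by auto
    have "(n, 0) \<in> nbrs (0, 1)"
      unfolding nbrs_def using links_twin[OF \<open>N = Suc n\<close>, of 1] by blast
    then have "((0, 1), (i, 0)) \<in> ?E" using V0 \<open>i = n\<close> by blast
    with cyc[OF V0(4)] show ?thesis by (rule rtrancl_into_rtrancl)
  qed
  then show ?thesis using cyc assms v by (meson rtrancl_trans)
qed

lemma state_values: "state h v = 1 \<or> state h v = - 1"
proof (cases v)
  case (Pair i j)
  then show ?thesis
    using cycle_state_values[of "p i" h j]
    by (cases "i < n"; cases "even i") (auto simp: state_def blinker_def)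
qed

lemma network_exists:
  assumes "T \<ge> 1" and T: "\<And>t. T dvd t \<longleftrightarrow> (\<forall>i<N. p i dvd t)"
  shows "\<exists>(G :: nat pair_pre_digraph) A B. connected_q2r_network G A B \<and>
    card (pverts G) = 2 * (\<Sum>i<N. p i) \<and> has_limit_cycle G A B T"
  unfolding card_network_verts[symmetric]
proof (rule network_of_trajectory[where enc = prod_encode and V = network_verts and nb = nbrs
      and red = "\<lambda>v. even (snd v)" and st = state and r = "(0, 0)"])
  show "inj prod_encode" by (rule inj_prod_encode)
  show "(0, 0) \<in> network_verts" using p0 N n by (auto simp: mem_network_verts)
  show "state 0 v \<in> {- 1, 1}" for v
    using state_values[of 0 v] by auto
  show "(\<forall>v\<in>network_verts. state (2 * t) v = state 0 v) \<longleftrightarrow> T dvd t" for t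
    unfolding T by (rule state_period)
qed (fact assms(1) nbrs_even finite_network_verts nbrs_subset nbrs_sym card_nbrs reachable state_Suc)+

end

section \<open>Prime periods\<close>

lemma prod_primes_dvd_iff:
  fixes P :: "nat set"
  assumes "finite P" "\<And>q. q \<in> P \<Longrightarrow> prime q"
  shows "\<Prod>P dvd t \<longleftrightarrow> (\<forall>q\<in>P. q dvd t)"
  using assms
proof (induction P rule: finite_induct)
  case (insert q P)
  have "coprime q (\<Prod>P)"
    using insert by (intro prod_coprime_right) (metis insertI1 insertI2 primes_coprime)
  then show ?case using insert by (auto intro: divides_mult dest: dvd_mult_left dvd_mult_right)
qed simp

lemma prime_network_exists:
  fixes P :: "nat set"
  assumes fin: "finite P" and ne: "P \<noteq> {}" and prime: "\<And>q. q \<in> P \<Longrightarrow> prime q"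
  shows "\<exists>(G :: nat pair_pre_digraph) A B. connected_q2r_network G A B \<and>
    card (pverts G) = 2 * \<Sum>P \<and> has_limit_cycle G A B (\<Prod>P)"
proof -
  \<comment> \<open>\<open>Q\<close> holds the primes realised by main cycles. The prime
    \<open>2\<close> is set aside for the gadget unless it is the only one; then
    \<open>n = 1\<close> and a single 4-cycle serves as main cycle.\<close>
  define Q where "Q = (if P = {2} then P else P - {2})"
  define n where "n = card Q"
  have finQ: "finite Q" and Q: "Q \<subseteq> P" using fin by (auto simp: Q_def)
  obtain e where e: "bij_betw e {..<n} Q"
    using ex_bij_betw_nat_finite[OF finQ] by (auto simp: n_def atLeast0LessThan)
  \<comment> \<open>The default \<open>2\<close> supplies \<open>p n\<close> for the gadget.\<close>
  define p where "p i = (if i < n then e i else 2)" for i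
  define N where "N = card P"
  have "bij_betw p {..<n} Q"
    using e by (rule bij_betw_cong[THEN iffD1, rotated]) (simp add: p_def)
  moreover have "N = n \<and> Q = P \<or> N = Suc n \<and> p n = 2 \<and> P = insert 2 Q \<and> 2 \<notin> Q"
  proof (cases "P = {2} \<or> 2 \<notin> P")
    case True
    then have "Q = P" by (auto simp: Q_def)
    then show ?thesis by (simp add: N_def n_def)
  next
    case False
    then have "P = insert 2 Q" "2 \<notin> Q" by (auto simp: Q_def)
    moreover from this have "N = Suc n" using finQ by (simp add: N_def n_def)
    ultimately show ?thesis by (simp add: p_def)
  qed
  ultimately have bij: "bij_betw p {..<N} P"
    by (auto simp: lessThan_Suc less_Suc_eq bij_betw_def)
  have "Q \<noteq> {}" using ne by (auto simp: Q_def)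
  interpret linked_cycles p n N
  proof
    show "n \<ge> 1" using \<open>Q \<noteq> {}\<close> finQ by (simp add: n_def Suc_le_eq card_gt_0_iff)
    show "p i \<ge> 2" if "i < n" for i
      using that prime Q \<open>bij_betw p {..<n} Q\<close> by (auto simp: bij_betw_def intro!: prime_ge_2_nat)
    show "odd (p i)" if "n \<ge> 2" "i < n" for i
    proof -
      have "P \<noteq> {2}" using \<open>n \<ge> 2\<close> by (auto simp: n_def Q_def)
      then have "p i \<in> P - {2}"
        using that \<open>bij_betw p {..<n} Q\<close> by (auto simp: bij_betw_def Q_def)
      then show ?thesis using prime by (metis DiffE insertI1 primes_dvd_imp_eq two_is_prime_nat)
    qed
    show "N = n \<or> N = Suc n \<and> p n = 2"
      using \<open>N = n \<and> Q = P \<or> _\<close> by blast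
  qed
  have P: "P = p ` {..<N}" using bij by (simp add: bij_betw_def)
  have "\<Prod>P \<ge> 1" using prime by (simp add: Suc_le_eq prod_pos prime_gt_0_nat)
  moreover have "\<Prod>P dvd t \<longleftrightarrow> (\<forall>i<N. p i dvd t)" for t
  proof -
    have "\<Prod>P dvd t \<longleftrightarrow> (\<forall>q\<in>P. q dvd t)"
      by (rule prod_primes_dvd_iff[OF fin prime])
    also have "\<dots> \<longleftrightarrow> (\<forall>i<N. p i dvd t)"
      unfolding P by blast
    finally show ?thesis .
  qed
  moreover have "(\<Sum>i<N. p i) = \<Sum>P"
    using sum.reindex_bij_betw[OF bij, of "\<lambda>q. q"] by simp
  ultimately show ?thesis using network_exists[of "\<Prod>P"] by simp
qed

theorem corollary1:
  shows "(\<forall>(k::nat) (p :: nat \<Rightarrow> nat).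
            k \<ge> 1 \<longrightarrow> (\<forall>i\<in>{1..k}. prime (p i)) \<longrightarrow> inj_on p {1..k} \<longrightarrow>
            (\<exists>(G :: nat pair_pre_digraph) A B.
               connected_q2r_network G A B \<and>
               card (pverts G) = 2 * (\<Sum>i=1..k. p i) \<and>
               has_limit_cycle G A B (\<Prod>i=1..k. p i)))
       \<and> (\<exists>(c::real) (G :: nat \<Rightarrow> nat pair_pre_digraph) (A :: nat \<Rightarrow> nat set) (B :: nat \<Rightarrow> nat set).
            c > 0 \<and>
            (\<forall>m. q2r_network (G m) (A m) (B m)) \<and>
            filterlim (\<lambda>m. card (pverts (G m))) at_top sequentially \<and>
            (\<forall>m. \<exists>T. has_limit_cycle (G m) (A m) (B m) T \<and>
                 real T \<ge> exp (c * sqrt (real (card (pverts (G m))) * ln (real (card (pverts (G m))))))))"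
proof (intro conjI allI impI)
  fix k :: nat and p :: "nat \<Rightarrow> nat"
  assume k: "k \<ge> 1" and prime: "\<forall>i\<in>{1..k}. prime (p i)" and inj: "inj_on p {1..k}"
  have "(\<Sum>i=1..k. p i) = \<Sum>(p ` {1..k})" "(\<Prod>i=1..k. p i) = \<Prod>(p ` {1..k})"
    using inj by (simp_all add: sum.reindex prod.reindex)
  moreover have "p ` {1..k} \<noteq> {}" using k by simp
  moreover have "\<And>q. q \<in> p ` {1..k} \<Longrightarrow> prime q" using prime by blast
  ultimately show "\<exists>(G :: nat pair_pre_digraph) A B. connected_q2r_network G A B \<and>
      card (pverts G) = 2 * (\<Sum>i=1..k. p i) \<and> has_limit_cycle G A B (\<Prod>i=1..k. p i)"
    using prime_network_exists[of "p ` {1..k}"] by simp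
next
  obtain M where M: "\<And>n. n \<ge> M \<Longrightarrow> real n \<ge> 4 * sqrt (real (2 * n)) * ln (real (2 * n))"
    using eventually_sqrt_mult_ln_le by (auto simp: eventually_sequentially)
  \<comment> \<open>Starting beyond the threshold \<open>M\<close> makes the bound hold for every
    \<open>m\<close> and not just eventually; \<open>Suc\<close> secures
    \<open>n m \<ge> 1\<close>.\<close>
  define n where "n m = Suc (M + m)" for m
  define P where "P m = {p. prime p \<and> p \<le> 2 * n m}" for m
  have "\<exists>(G :: nat pair_pre_digraph) A B. connected_q2r_network G A B \<and>
      card (pverts G) = 2 * \<Sum>(P m) \<and> has_limit_cycle G A B (\<Prod>(P m))" for m
  proof (rule prime_network_exists)
    have "2 \<in> P m" by (simp add: P_def n_def)
    then show "P m \<noteq> {}" by blast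
  qed (auto simp: P_def)
  then obtain G :: "nat \<Rightarrow> nat pair_pre_digraph" and A B where net:
    "\<And>m. connected_q2r_network (G m) (A m) (B m)"
    "\<And>m. card (pverts (G m)) = 2 * \<Sum>(P m)"
    "\<And>m. has_limit_cycle (G m) (A m) (B m) (\<Prod>(P m))"
    by metis
  have bound: "exp (1 / 20 * sqrt (real (card (pverts (G m))) * ln (real (card (pverts (G m))))))
      \<le> real (\<Prod>(P m))" "sqrt (real (n m)) \<le> real (card (pverts (G m)))" for m
    using prime_product_ge_exp[of "n m"] M[of "n m"] unfolding net(2) P_def by (simp_all add: n_def)
  have "filterlim (\<lambda>m. sqrt (real (n m))) at_top sequentially"
    unfolding n_def by real_asymp
  then have "filterlim (\<lambda>m. real (card (pverts (G m)))) at_top sequentially"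
    by (rule filterlim_at_top_mono) (simp add: bound(2))
  then have "filterlim (\<lambda>m. card (pverts (G m))) at_top sequentially"
    by (simp add: filterlim_sequentially_iff_filterlim_real)
  moreover have "q2r_network (G m) (A m) (B m)" for m
    using net(1) by (simp add: connected_q2r_network_def)
  moreover have "\<exists>T. has_limit_cycle (G m) (A m) (B m) T \<and>
      real T \<ge> exp (1 / 20 * sqrt (real (card (pverts (G m))) * ln (real (card (pverts (G m))))))" for m
    using net(3)[of m] bound(1)[of m] by blast
  ultimately have "(1 / 20 :: real) > 0 \<and> (\<forall>m. q2r_network (G m) (A m) (B m)) \<and>
      filterlim (\<lambda>m. card (pverts (G m))) at_top sequentially \<and>
      (\<forall>m. \<exists>T. has_limit_cycle (G m) (A m) (B m) T \<and>
        real T \<ge> exp (1 / 20 * sqrt (real (card (pverts (G m))) * ln (real (card (pverts (G m)))))))"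
    by (intro conjI allI) (simp, assumption+)
  then show "\<exists>(c::real) (G :: nat \<Rightarrow> nat pair_pre_digraph) (A :: nat \<Rightarrow> nat set) (B :: nat \<Rightarrow> nat set).
      c > 0 \<and> (\<forall>m. q2r_network (G m) (A m) (B m)) \<and>
      filterlim (\<lambda>m. card (pverts (G m))) at_top sequentially \<and>
      (\<forall>m. \<exists>T. has_limit_cycle (G m) (A m) (B m) T \<and>
        real T \<ge> exp (c * sqrt (real (card (pverts (G m))) * ln (real (card (pverts (G m)))))))"
    by blast
qed

end
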